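(* Let $p/q$ be a rational number in lowest terms ($q\geq 1$), and let its continued fraction expansion be $\frac{p}{q}=[a_0;a_1,a_2,\ldots,a_{2k}]$ for some integer $k\geq 0$ (with $a_0\in\mathbb{Z}$ and $a_1,\ldots,a_{2k}$ positive integers). Let $q_n$ denote the denominators of the convergents, defined by $q_{-1}=0$, $q_0=1$, $q_n=a_nq_{n-1}+q_{n-2}$. Let $(z_n)_{n\geq 1}$ be any sequence of positive integers. Define sequences $(x_n)_{n\geq1}$ and $(y_n)_{n\geq 0}$ by $$x_1=q,\qquad y_0=q_{2k-1}+1,\qquad x_{n+1}=x_n\,y_{n-1}\,(x_nz_n+1)\ \ (n\geq 1),\qquad y_n=\frac{x_{n+1}}{x_n}\ \ (n\geq 1).$$ Then for all $n\geq 1$ the partial sums $$S_n:=\frac{p}{q}+\sum_{j=2}^n\frac{1}{x_j}$$ satisfy $$S_n=[a_0;a_1,\ldots,a_{2(k+n-1)}],$$ where the coefficients after $a_{2k}$ are given by $a_{2k+2j-1}=y_{j-1}z_j$ and $a_{2k+2j}=x_j$ for $j\geq 1$.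
   Context: Notation: $[a_0;a_1,\ldots,a_n]=a_0+\cfrac{1}{a_1+\cfrac{1}{a_2+\cdots+\cfrac{1}{a_n}}}$ denotes a finite continued fraction. The sequences $(x_n)$ and $(y_n)$ consist of positive integers, and $x_n$ divides $x_{n+1}$ for all $n\geq1$. *)

theory Defs
  imports Complex_Main
begin

fun cfrac :: "int list \<Rightarrow> rat" where
  "cfrac [] = 0"
| "cfrac [a] = of_int a"
| "cfrac (a # b # as) = of_int a + 1 / cfrac (b # as)"

end

theory Submission imports Defs begin

text \<open>
  Write \<open>P\<^sub>n / Q\<^sub>n\<close> for the convergents. By induction \<open>Q\<^bsub>2(k+n-1)\<^esub> = x\<^sub>n\<close> and
  \<open>Q\<^bsub>2(k+n-1)-1\<^esub> = y\<^bsub>n-1\<^esub> - 1\<close>: with \<open>m = 2(k+n-1)\<close>, the recurrence gives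
  \<open>Q\<^bsub>m+1\<^esub> = y\<^bsub>n-1\<^esub> z\<^sub>n x\<^sub>n + y\<^bsub>n-1\<^esub> - 1 = y\<^sub>n - 1\<close> and \<open>Q\<^bsub>m+2\<^esub> = x\<^sub>n (y\<^sub>n - 1) + x\<^sub>n = x\<^bsub>n+1\<^esub>\<close>.
  As \<open>m\<close> is even, two consecutive even convergents differ by
  \<open>a\<^bsub>m+2\<^esub> / (Q\<^sub>m Q\<^bsub>m+2\<^esub>) = x\<^sub>n / (x\<^sub>n x\<^bsub>n+1\<^esub>) = 1 / x\<^bsub>n+1\<^esub>\<close>.
\<close>

text \<open>
  Indices are shifted by one: \<open>cf_num a (n + 1)\<close> and \<open>cf_den a (n + 1)\<close> belong to the
  \<open>n\<close>-th convergent, and index \<open>0\<close> holds the initial values usually indexed by \<open>-1\<close>.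
\<close>

fun cf_num :: "(nat \<Rightarrow> int) \<Rightarrow> nat \<Rightarrow> int" where
  "cf_num a 0 = 1"
| "cf_num a (Suc 0) = a 0"
| "cf_num a (Suc (Suc n)) = a (Suc n) * cf_num a (Suc n) + cf_num a n"

fun cf_den :: "(nat \<Rightarrow> int) \<Rightarrow> nat \<Rightarrow> int" where
  "cf_den a 0 = 0"
| "cf_den a (Suc 0) = 1"
| "cf_den a (Suc (Suc n)) = a (Suc n) * cf_den a (Suc n) + cf_den a n"

text \<open>Both sides obey the same recurrence from the same initial values. This and the next
  lemma let coefficients be peeled off at the front, as \<open>cfrac\<close> does, although the
  recurrences extend at the back.\<close>

lemma cf_den_Suc_shift: "cf_den a (Suc n) = cf_num (a \<circ> Suc) n"
  by (induction n rule: induct_nat_012) auto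

lemma cf_num_Suc_shift:
  "cf_num a (Suc n) = a 0 * cf_num (a \<circ> Suc) n + cf_den (a \<circ> Suc) n"
  by (induction n rule: induct_nat_012) (auto simp: algebra_simps)

lemma cf_den_pos:
  assumes "\<And>i. 1 \<le> i \<Longrightarrow> i \<le> n \<Longrightarrow> a i > 0"
  shows "cf_den a (Suc n) > 0"
  using assms by (induction n rule: induct_nat_012) (auto intro!: add_pos_pos)

lemma cfrac_eq_convergent:
  assumes "\<And>i. 1 \<le> i \<Longrightarrow> i \<le> n \<Longrightarrow> a i > 0"
  shows "cfrac (map a [0..<Suc n]) = of_int (cf_num a (Suc n)) / of_int (cf_den a (Suc n))"
  using assms
proof (induction n arbitrary: a)
  case 0
  then show ?case by simp
next
  case (Suc n)
  let ?b = "a \<circ> Suc"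
  have IH: "cfrac (map ?b [0..<Suc n]) = of_int (cf_num ?b (Suc n)) / of_int (cf_den ?b (Suc n))"
    by (rule Suc.IH) (use Suc.prems in auto)
  have "map a [0..<Suc (Suc n)] = a 0 # map ?b [0..<Suc n]"
    by (simp add: upt_conv_Cons map_Suc_upt[symmetric] o_assoc del: upt_Suc)
  also have "cfrac \<dots> = of_int (a 0) + 1 / cfrac (map ?b [0..<Suc n])"
    by (simp add: upt_conv_Cons del: upt_Suc)
  finally have "cfrac (map a [0..<Suc (Suc n)])
      = of_int (a 0) + of_int (cf_den ?b (Suc n)) / of_int (cf_num ?b (Suc n))"
    by (simp only: IH) simp
  moreover have "cf_num ?b (Suc n) > 0"
    using cf_den_pos[of "Suc n" a] Suc.prems by (simp only: cf_den_Suc_shift)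
  ultimately show ?case
    by (simp add: cf_den_Suc_shift[of a "Suc n"] cf_num_Suc_shift[of a "Suc n"]
        add_divide_distrib del: cf_num.simps cf_den.simps upt_Suc)
qed

lemma cf_determinant:
  "cf_num a (Suc n) * cf_den a n - cf_num a n * cf_den a (Suc n) = (-1) ^ Suc n"
  by (induction n) (simp_all add: algebra_simps)

text \<open>A common divisor divides the determinant, which is 1 or -1.\<close>

lemma coprime_cf_num_cf_den: "coprime (cf_num a n) (cf_den a n)"
proof (rule coprimeI)
  fix c assume "c dvd cf_num a n" "c dvd cf_den a n"
  then have "c dvd cf_num a (Suc n) * cf_den a n - cf_num a n * cf_den a (Suc n)"
    by simp
  then show "is_unit c"
    unfolding cf_determinant by (metis dvd_trans is_unit_power_iff dvd_minus_iff dvd_refl)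
qed

text \<open>Expanding the last recurrence, the cross difference of convergents two apart is the new
  coefficient times a determinant of neighbours; evenness of \<open>n\<close> makes that determinant
  +1.\<close>

lemma convergent_even_step:
  assumes "even n" "cf_den a (Suc n) \<noteq> 0" "cf_den a (Suc (Suc (Suc n))) \<noteq> 0"
  shows "(of_int (cf_num a (Suc (Suc (Suc n)))) / of_int (cf_den a (Suc (Suc (Suc n)))) :: rat)
    = of_int (cf_num a (Suc n)) / of_int (cf_den a (Suc n))
      + of_int (a (Suc (Suc n))) / of_int (cf_den a (Suc n) * cf_den a (Suc (Suc (Suc n))))"
proof -
  let ?N = "cf_num a (Suc (Suc (Suc n)))" and ?D = "cf_den a (Suc (Suc (Suc n)))"
  have "cf_num a (Suc (Suc n)) * cf_den a (Suc n) - cf_num a (Suc n) * cf_den a (Suc (Suc n)) = 1"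
    using cf_determinant[of a "Suc n"] assms(1) by simp
  moreover have "?N * cf_den a (Suc n) - cf_num a (Suc n) * ?D
      = a (Suc (Suc n)) * (cf_num a (Suc (Suc n)) * cf_den a (Suc n)
          - cf_num a (Suc n) * cf_den a (Suc (Suc n)))"
    by (simp only: cf_num.simps(3)[of a "Suc n"] cf_den.simps(3)[of a "Suc n"])
      (simp only: algebra_simps)
  ultimately have "?N * cf_den a (Suc n) = cf_num a (Suc n) * ?D + a (Suc (Suc n))"
    by simp
  then have "(of_int ?N * of_int (cf_den a (Suc n)) :: rat)
      = of_int (cf_num a (Suc n)) * of_int ?D + of_int (a (Suc (Suc n)))"
    by (simp only: of_int_mult[symmetric] of_int_add[symmetric])
  then show ?thesis
    using assms(2,3) by (simp add: field_simps del: cf_num.simps cf_den.simps)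
qed

lemma coprime_fraction_eq_den:
  fixes p q r s :: int
  assumes "coprime p q" "coprime r s" "q > 0" "s > 0"
    and "(of_int p / of_int q :: rat) = of_int r / of_int s"
  shows "q = s"
proof -
  have "(of_int (p * s) :: rat) = of_int (r * q)"
    using assms by (simp add: field_simps)
  then have eq: "p * s = r * q"
    by (simp only: of_int_eq_iff)
  have "q dvd s"
    using eq assms(1) by (metis coprime_commute coprime_dvd_mult_right_iff dvd_triv_right)
  moreover have "s dvd q"
    using eq assms(2) by (metis coprime_commute coprime_dvd_mult_right_iff dvd_triv_right)
  ultimately show ?thesis
    using assms(3,4) by (simp add: zdvd_antisym_nonneg)
qed

theorem theorem1:
  fixes p q :: int and k :: nat
    and a :: "nat \<Rightarrow> int"
    and Q :: "int \<Rightarrow> int"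
    and x y z :: "nat \<Rightarrow> int"
  assumes "q \<ge> 1" and "coprime p q"
    and "of_int p / of_int q = cfrac (map a [0..<2*k+1])"
    and "\<forall>i\<in>{1..2*k}. a i > 0"
    and "Q (-1) = 0" and "Q 0 = 1"
    and "\<forall>n\<ge>1. Q (int n) = a n * Q (int n - 1) + Q (int n - 2)"
    and "\<forall>n\<ge>1. z n > 0"
    and "x 1 = q" and "y 0 = Q (2 * int k - 1) + 1"
    and "\<forall>n\<ge>1. x (n + 1) = x n * y (n - 1) * (x n * z n + 1)"
    and "\<forall>n\<ge>1. (of_int (y n) :: rat) = of_int (x (n + 1)) / of_int (x n)"
    and "\<forall>j\<ge>1. a (2*k + 2*j - 1) = y (j - 1) * z j"
    and "\<forall>j\<ge>1. a (2*k + 2*j) = x j"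
  shows "\<forall>n\<ge>1. of_int p / of_int q + (\<Sum>j=2..n. 1 / of_int (x j))
      = cfrac (map a [0..<2*(k+n-1)+1])"
proof -
  have den_Q: "cf_den a n = Q (int n - 1)" for n
  proof (induction n rule: induct_nat_012)
    case (ge2 n)
    then show ?case
      using assms(7)[rule_format, of "Suc n"] by (simp add: add.commute)
  qed (use assms(5,6) in auto)
  \<comment> \<open>The expansion fixes only the value p/q. Both fractions are reduced with positive
    denominators, so the denominators agree.\<close>
  have den_q: "cf_den a (Suc (2*k)) = q"
    by (rule sym, rule coprime_fraction_eq_den[OF assms(2) coprime_cf_num_cf_den])
      (use assms(1,3,4) cf_den_pos[of "2*k" a] cfrac_eq_convergent[of "2*k" a] in auto)
  have y_Suc: "y n = y (n - 1) * (x n * z n + 1)" if "n \<ge> 1" "x n > 0" for n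
  proof -
    have "(of_int (y n) :: rat) = of_int (y (n - 1) * (x n * z n + 1))"
      using assms(11,12) that by (simp add: field_simps)
    then show ?thesis
      by (simp only: of_int_eq_iff)
  qed
  \<comment> \<open>Positivity is carried along because \<open>y_Suc\<close> cancels
    \<open>x (Suc n)\<close>, and because \<open>a_pos\<close> draws on it beyond index 2k.\<close>
  have inv: "x (Suc n) > 0 \<and> y n > 0 \<and> cf_den a (Suc (2*(k+n))) = x (Suc n)
      \<and> cf_den a (2*(k+n)) = y n - 1" for n
  proof (induction n)
    case 0
    \<comment> \<open>For k = 0 this is the initial value 0, so \<open>y 0\<close> is 1; hence only
      a weak inequality.\<close>
    have "cf_den a (2*k) \<ge> 0"
      using cf_den_pos[of "2*k - 1" a] assms(4) by (cases k) auto
    then show ?case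
      using den_q den_Q[of "2*k"] assms(1,9,10) by simp
  next
    case (Suc n)
    define m where "m = 2*(k+n)"
    have m2: "2*(k + Suc n) = Suc (Suc m)"
      by (simp add: m_def)
    have a1: "a (Suc m) = y n * z (Suc n)" and a2: "a (Suc (Suc m)) = x (Suc n)"
      using assms(13,14)[rule_format, of "Suc n"] by (simp_all add: m_def)
    have IH: "x (Suc n) > 0" "y n > 0" "cf_den a (Suc m) = x (Suc n)" "cf_den a m = y n - 1"
      using Suc.IH by (simp_all add: m_def)
    have z: "z (Suc n) > 0"
      using assms(8) by simp
    have y: "y (Suc n) = y n * (x (Suc n) * z (Suc n) + 1)"
      using y_Suc[of "Suc n"] IH by simp
    have x: "x (Suc (Suc n)) = x (Suc n) * y (Suc n)"
      using assms(11)[rule_format, of "Suc n"] y by simp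
    have ypos: "y (Suc n) > 0"
      unfolding y using IH z by (intro mult_pos_pos add_pos_pos) auto
    have d2: "cf_den a (Suc (Suc m)) = y (Suc n) - 1"
      using IH a1 y by (simp add: algebra_simps)
    have "cf_den a (Suc (Suc (Suc m))) = x (Suc (Suc n))"
      using IH a2 d2 x by (simp only: cf_den.simps(3)[of a "Suc m"]) (simp add: algebra_simps)
    with d2 ypos show ?case
      using IH(1) x unfolding m2 by simp
  qed
  have a_pos: "a i > 0" if "i \<ge> 1" for i
  proof (cases "i \<le> 2*k")
    case True
    with that assms(4) show ?thesis by simp
  next
    case False
    \<comment> \<open>\<open>j\<close> counts the complete pairs of appended coefficients before
      index \<open>i\<close>.\<close>
    define j where "j = (i - 2*k - 1) div 2"
    have "i = 2*k + 2*Suc j - 1 \<or> i = 2*k + 2*Suc j"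
      using False unfolding j_def by presburger
    then consider "i = 2*k + 2*Suc j - 1" | "i = 2*k + 2*Suc j"
      by blast
    then show ?thesis
    proof cases
      case 1
      then have "a i = y j * z (Suc j)"
        using assms(13)[rule_format, of "Suc j"] by simp
      then show ?thesis
        using inv[of j] assms(8) by simp
    next
      case 2
      then have "a i = x (Suc j)"
        using assms(14)[rule_format, of "Suc j"] by simp
      then show ?thesis
        using inv[of j] by simp
    qed
  qed
  have cfrac_conv: "cfrac (map a [0..<n+1])
      = of_int (cf_num a (Suc n)) / of_int (cf_den a (Suc n))" for n
    using cfrac_eq_convergent[of n a] a_pos by simp
  \<comment> \<open>Shifting \<open>n\<close> by one avoids truncated subtraction; at 0 the sum is
    empty and the hypothesis on p/q remains.\<close>
  have main: "of_int p / of_int q + (\<Sum>j=2..Suc n. 1 / of_int (x j))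
      = cfrac (map a [0..<2*(k+n)+1])" for n
  proof (induction n)
    case 0
    then show ?case
      using assms(3) by simp
  next
    case (Suc n)
    define m where "m = 2*(k+n)"
    have m2: "2*(k + Suc n) = Suc (Suc m)"
      by (simp add: m_def)
    have d: "cf_den a (Suc m) = x (Suc n)" "cf_den a (Suc (Suc (Suc m))) = x (Suc (Suc n))"
      and pos: "x (Suc n) > 0" "x (Suc (Suc n)) > 0"
      using inv[of n] inv[of "Suc n"] unfolding m2 m_def by simp_all
    have a2: "a (Suc (Suc m)) = x (Suc n)"
      using assms(14)[rule_format, of "Suc n"] by (simp add: m_def)
    have "cfrac (map a [0..<Suc (Suc m)+1]) = cfrac (map a [0..<m+1]) + 1 / of_int (x (Suc (Suc n)))"
      unfolding cfrac_conv
      by (subst convergent_even_step) (use d pos a2 in \<open>simp_all add: m_def del: cf_num.simps cf_den.simps\<close>)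
    then show ?case
      using Suc.IH unfolding m2 m_def[symmetric] by (simp add: add.assoc[symmetric])
  qed
  show ?thesis
  proof (intro allI impI)
    fix n :: nat
    assume "n \<ge> 1"
    then show "of_int p / of_int q + (\<Sum>j=2..n. 1 / of_int (x j))
        = cfrac (map a [0..<2*(k+n-1)+1])"
      using main[of "n - 1"] by simp
  qed
qed

end
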